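(* Let $\mathfrak h$ be the limiting height function of the uniform domino tiling model on a planar domain $\Omega$, with liquid region $\mathcal L$, let $(s,t)=\nabla\mathfrak h$, let $c=\mathfrak h-(sx+ty)$ be the intercept function on $\mathcal L$, and let $u:\mathcal L\to\Sigma^+$ be the parametrization of $\mathcal L$ by the Riemann surface $\Sigma^+$ covering the upper half of the spectral curve. Then the functions $s$, $t$ and $c$, regarded as functions of the variable $u\in\Sigma^+$, are harmonic on $\Sigma^+$.
   Context: **Ronkin function and surface tension.** Let $P(z,w)=1+z+w-zw$, and $$\mathcal R(X,Y)=\frac1{(2\pi i)^2}\iint_{|z|=|w|=1}\log|P(e^Xz,e^Yw)|\,\frac{dz}{z}\frac{dw}{w},\qquad (X,Y)\in\mathbb R^2 .$$ Let $\sigma_0:[0,1]^2\to\mathbb R$ be the Legendre transform $\sigma_0(s,t)=\sup_{X,Y}\big(sX+tY-\mathcal R(X,Y)\big)$; it is smooth and strictly convex on $(0,1)^2$. All slopes are translated by the vector $(1,-1)$ (i.e. $x-y$ is added to all height functions), so the set of allowed slopes is $\mathcal N=[1,2]\times[-1,0]$ and the surface tension is $\sigma(s,t)=\sigma_0(s-1,t+1)$. **Minimizer and liquid region.** $\Omega\subset\mathbb R^2$ is a bounded domain and $\mathfrak h:\Omega\to\mathbb R$ is the minimizer of $\int_\Omega\sigma(\nabla h)\,dx\,dy$ among Lipschitz functions $h$ with $\nabla h\in\mathcal N$ a.e. and given boundary conditions. The liquid region $\mathcal L$ is the open subset of $\Omega$ where $\nabla\mathfrak h$ lies in the interior of $\mathcal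 N$. Standing facts: $\mathfrak h$ is smooth on $\mathcal L$ and satisfies there $\partial_x\big(\sigma_s(\nabla\mathfrak h)\big)+\partial_y\big(\sigma_t(\nabla\mathfrak h)\big)=0$. **Complex slope.** On $\mathcal L$ there are smooth functions $z,w$ with $P(z,w)=0$, $\arg z=-\pi t\in(0,\pi)$, $\arg w=\pi s\in(\pi,2\pi)$ (where $(s,t)=\nabla\mathfrak h$), $(\log|z|,\log|w|)=\nabla\sigma(s,t)$, and $\frac{z_x}{z}+\frac{w_y}{w}=0$. In particular $z$ takes values in the upper half-plane $\mathbb H$. **The parametrization $u$.** The map $\nabla\mathfrak h$ from $\mathcal L$ to the interior of $\mathcal N$ may have degree $d\ge1$. One introduces a Riemann surface $\Sigma$ which is a degree-$d$ ramified covering of the spectral curve $\{P(z,w)=0\}$, so that $z$ and $w$ become meromorphic functions on $\Sigma$; $\Sigma^+$ is the preimage of $\mathbb H$ under $z$, and there is a diffeomorphism $u:\mathcal L\to\Sigma^+$ such that the functions $z(x,y),w(x,y)$ on $\mathcal L$ equal the meromorphic functions $z,w$ on $\Sigma^+$ composed with $u$. In particular $z,w$ are holomorphic and non-vanishing on $\Sigma^+$. Functions on $\mathcal L$ are regarded as functions of $u\in\Sigma^+$ via this diffeomorphism. Harmonic means $\partial_u\partial_{\bar u}f=0$ in local holomorphic coordinates $u$ on $\Sigma^+$. *)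

theory Defs
  imports "HOL-Complex_Analysis.Complex_Analysis"
begin

definition pd :: "'a::real_normed_vector \<Rightarrow> ('a \<Rightarrow> 'b::real_normed_vector) \<Rightarrow> 'a \<Rightarrow> 'b" where
  "pd v f p = frechet_derivative f (at p) v"

abbreviation pd_x :: "(real \<times> real \<Rightarrow> 'b::real_normed_vector) \<Rightarrow> real \<times> real \<Rightarrow> 'b" where
  "pd_x \<equiv> pd (1, 0)"

abbreviation pd_y :: "(real \<times> real \<Rightarrow> 'b::real_normed_vector) \<Rightarrow> real \<times> real \<Rightarrow> 'b" where
  "pd_y \<equiv> pd (0, 1)"

definition grad :: "(real \<times> real \<Rightarrow> real) \<Rightarrow> real \<times> real \<Rightarrow> real \<times> real" where
  "grad f p = (pd_x f p, pd_y f p)"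

text \<open>\<open>C_on k S f\<close>: the function \<open>f\<close> is of class \<open>C\<^sup>k\<close> on \<open>S\<close>.
  This is only meaningful for open \<open>S\<close>. The plane appears below both as \<open>real \<times> real\<close>
  and as \<open>complex\<close>.\<close>

primrec C_on :: "nat \<Rightarrow> 'a::euclidean_space set \<Rightarrow> ('a \<Rightarrow> 'b::real_normed_vector) \<Rightarrow> bool" where
  "C_on 0 S f \<longleftrightarrow> continuous_on S f"
| "C_on (Suc k) S f \<longleftrightarrow>
     (\<forall>p\<in>S. f differentiable (at p)) \<and> (\<forall>b\<in>Basis. C_on k S (pd b f))"

definition smooth_on :: "'a::euclidean_space set \<Rightarrow> ('a \<Rightarrow> 'b::real_normed_vector) \<Rightarrow> bool" where
  "smooth_on S f \<longleftrightarrow> (\<forall>k. C_on k S f)"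

definition d_hol :: "(complex \<Rightarrow> complex) \<Rightarrow> complex \<Rightarrow> complex" where
  "d_hol F \<zeta> = (pd 1 F \<zeta> - \<i> * pd \<i> F \<zeta>) / 2"

definition d_antihol :: "(complex \<Rightarrow> complex) \<Rightarrow> complex \<Rightarrow> complex" where
  "d_antihol F \<zeta> = (pd 1 F \<zeta> + \<i> * pd \<i> F \<zeta>) / 2"

definition dimer_poly :: "complex \<Rightarrow> complex \<Rightarrow> complex" where
  "dimer_poly z w = 1 + z + w - z * w"

text \<open>The integral over the torus is written as an iterated contour integral. Its value is real,
  so taking the real part only adjusts the type. The convention \<open>ln 0 = 0\<close> is harmless: for fixed
  \<open>z\<close> the polynomial is nonzero of degree at most one in \<open>w\<close>, so the inner integrand has at most
  one singular point, where the logarithm is integrable.\<close>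

definition ronkin :: "real \<Rightarrow> real \<Rightarrow> real" where
  "ronkin X Y = Re (1 / (2 * of_real pi * \<i>)\<^sup>2 *
     contour_integral (circlepath 0 1) (\<lambda>z.
       contour_integral (circlepath 0 1) (\<lambda>w.
         of_real (ln (cmod (dimer_poly (exp (of_real X) * z) (exp (of_real Y) * w)))) / w) / z))"

definition surface_tension0 :: "real \<times> real \<Rightarrow> real" where
  "surface_tension0 = (\<lambda>(s, t). SUP (X, Y). s * X + t * Y - ronkin X Y)"

definition slopes :: "(real \<times> real) set" where
  "slopes = {1..2} \<times> {-1..0}"

definition surface_tension :: "real \<times> real \<Rightarrow> real" where
  "surface_tension = (\<lambda>(s, t). surface_tension0 (s - 1, t + 1))"

text \<open>The boundary values are prescribed by a function \<open>b\<close> on the frontier, so competitors are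
  functions on the closure. Differentiability almost everywhere is automatic for Lipschitz
  functions; it is stated because \<open>grad\<close> is unspecified at other points.\<close>

definition admissible :: "(real \<times> real) set \<Rightarrow> (real \<times> real \<Rightarrow> real) \<Rightarrow> (real \<times> real \<Rightarrow> real) \<Rightarrow> bool" where
  "admissible \<Omega> b h \<longleftrightarrow>
     (\<exists>K. K-lipschitz_on (closure \<Omega>) h) \<and>
     (\<forall>p\<in>frontier \<Omega>. h p = b p) \<and>
     (AE p in lebesgue. p \<in> \<Omega> \<longrightarrow> h differentiable (at p) \<and> grad h p \<in> slopes)"

definition total_tension :: "(real \<times> real) set \<Rightarrow> (real \<times> real \<Rightarrow> real) \<Rightarrow> real" where
  "total_tension \<Omega> h = (LINT p:\<Omega>|lebesgue. surface_tension (grad h p))"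

definition limiting_height :: "(real \<times> real) set \<Rightarrow> (real \<times> real \<Rightarrow> real) \<Rightarrow> (real \<times> real \<Rightarrow> real) \<Rightarrow> bool" where
  "limiting_height \<Omega> b h \<longleftrightarrow>
     admissible \<Omega> b h \<and> (\<forall>g. admissible \<Omega> b g \<longrightarrow> total_tension \<Omega> h \<le> total_tension \<Omega> g)"

definition liquid_region :: "(real \<times> real) set \<Rightarrow> (real \<times> real \<Rightarrow> real) \<Rightarrow> (real \<times> real) set" where
  "liquid_region \<Omega> h = {p \<in> \<Omega>. h differentiable (at p) \<and> grad h p \<in> interior slopes}"

definition intercept :: "(real \<times> real \<Rightarrow> real) \<Rightarrow> real \<times> real \<Rightarrow> real" where
  "intercept h = (\<lambda>(x, y). h (x, y) - (fst (grad h (x, y)) * x + snd (grad h (x, y)) * y))"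

type_synonym 'a chart = "'a set \<times> ('a \<Rightarrow> complex)"

text \<open>Connectedness is not required: a liquid region, and hence a surface parametrizing it,
  may have several components.\<close>

definition riemann_surface :: "'a topology \<Rightarrow> 'a chart set \<Rightarrow> bool" where
  "riemann_surface X A \<longleftrightarrow>
     Hausdorff_space X \<and> second_countable X \<and> \<Union> (fst ` A) = topspace X \<and>
     (\<forall>(U, \<phi>)\<in>A. openin X U \<and> open (\<phi> ` U) \<and>
        homeomorphic_map (subtopology X U) (top_of_set (\<phi> ` U)) \<phi>) \<and>
     (\<forall>(U, \<phi>)\<in>A. \<forall>(V, \<psi>)\<in>A. (\<psi> \<circ> inv_into U \<phi>) holomorphic_on \<phi> ` (U \<inter> V))"

definition holomorphic_map ::
  "'a topology \<Rightarrow> 'a chart set \<Rightarrow> 'b topology \<Rightarrow> 'b chart set \<Rightarrow> ('a \<Rightarrow> 'b) \<Rightarrow> bool" where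
  "holomorphic_map X A Y B F \<longleftrightarrow>
     continuous_map X Y F \<and>
     (\<forall>(U, \<phi>)\<in>A. \<forall>(V, \<psi>)\<in>B. (\<psi> \<circ> F \<circ> inv_into U \<phi>) holomorphic_on \<phi> ` (U \<inter> F -` V))"

definition chart_at :: "'a chart set \<Rightarrow> 'a \<Rightarrow> 'a chart" where
  "chart_at A p = (SOME c. c \<in> A \<and> p \<in> fst c)"

text \<open>The vanishing order at \<open>p\<close> of \<open>F - F p\<close> in local coordinates does not depend on the choice
  of the charts. For locally constant \<open>F\<close> the value is unspecified; this does not occur below
  because fibres are required to be finite.\<close>

definition ramification_index :: "'a chart set \<Rightarrow> 'b chart set \<Rightarrow> ('a \<Rightarrow> 'b) \<Rightarrow> 'a \<Rightarrow> int" where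
  "ramification_index A B F p =
     (let (U, \<phi>) = chart_at A p; (V, \<psi>) = chart_at B (F p)
      in zorder (\<lambda>\<zeta>. \<psi> (F (inv_into U \<phi> \<zeta>)) - \<psi> (F p)) (\<phi> p))"

definition ramified_covering ::
  "nat \<Rightarrow> 'a topology \<Rightarrow> 'a chart set \<Rightarrow> 'b topology \<Rightarrow> 'b chart set \<Rightarrow> ('a \<Rightarrow> 'b) \<Rightarrow> bool" where
  "ramified_covering d X A Y B F \<longleftrightarrow>
     holomorphic_map X A Y B F \<and> proper_map X Y F \<and>
     (\<forall>q\<in>topspace Y. finite {p \<in> topspace X. F p = q} \<and>
        (\<Sum>p | p \<in> topspace X \<and> F p = q. ramification_index A B F p) = int d)"

definition harmonic_on :: "'a chart set \<Rightarrow> 'a set \<Rightarrow> ('a \<Rightarrow> real) \<Rightarrow> bool" where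
  "harmonic_on A S f \<longleftrightarrow>
     (\<forall>(U, \<phi>)\<in>A. let F = (\<lambda>\<zeta>. complex_of_real (f (inv_into U \<phi> \<zeta>))) in
        C_on 2 (\<phi> ` (U \<inter> S)) F \<and> (\<forall>\<zeta>\<in>\<phi> ` (U \<inter> S). d_hol (d_antihol F) \<zeta> = 0))"

definition surface_diffeo ::
  "(real \<times> real) set \<Rightarrow> 'a chart set \<Rightarrow> 'a set \<Rightarrow> (real \<times> real \<Rightarrow> 'a) \<Rightarrow> bool" where
  "surface_diffeo L A S u \<longleftrightarrow>
     bij_betw u L S \<and>
     (\<forall>(U, \<phi>)\<in>A. open (L \<inter> u -` U) \<and> smooth_on (L \<inter> u -` U) (\<phi> \<circ> u) \<and>
        smooth_on (\<phi> ` (U \<inter> S)) (inv_into L u \<circ> inv_into U \<phi>))"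

text \<open>The point \<open>None\<close> of the Riemann sphere is infinity. A meromorphic function is a holomorphic
  map to the sphere.\<close>

abbreviation sphere :: "complex option topology" where
  "sphere \<equiv> Alexandroff_compactification euclidean"

definition sphere_charts :: "complex option chart set" where
  "sphere_charts =
     {(range Some, the), (UNIV - {Some 0}, case_option 0 inverse)}"

text \<open>The spectral curve is completed in the product of two spheres, so that a covering of finite
  degree carries meromorphic coordinate functions \<open>z\<close> and \<open>w\<close>. This adds the two points
  \<open>(1, \<infinity>)\<close> and \<open>(\<infinity>, 1)\<close>. Since \<open>dimer_poly z w = 0\<close> determines \<open>w\<close> from \<open>z\<close> as a Moebius transformation,
  the first coordinate identifies the completed curve with the sphere.\<close>

definition spectral_curve :: "(complex option \<times> complex option) topology" where
  "spectral_curve = subtopology (prod_topology sphere sphere)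
     ((prod_topology sphere sphere) closure_of {(Some z, Some w) | z w. dimer_poly z w = 0})"

definition spectral_charts :: "(complex option \<times> complex option) chart set" where
  "spectral_charts =
     {(topspace spectral_curve \<inter> fst -` U, \<phi> \<circ> fst) | U \<phi>. (U, \<phi>) \<in> sphere_charts}"

definition upper_part ::
  "'a topology \<Rightarrow> ('a \<Rightarrow> complex option \<times> complex option) \<Rightarrow> 'a set" where
  "upper_part X F = {\<xi> \<in> topspace X. \<exists>\<zeta>. fst (F \<xi>) = Some \<zeta> \<and> Im \<zeta> > 0}"

end

theory Submission
  imports Defs
begin

text \<open>In a chart \<open>\<zeta>\<close>, the slopes \<open>s\<close> and \<open>t\<close> are, up to constants, the imaginary parts of the
  holomorphic functions \<open>Gs = log w / pi\<close> and \<open>Gt = - log z / pi\<close>. Since \<open>dc = - x ds - y dt\<close>,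
  the mixed derivative of \<open>c\<close> only involves first derivatives of \<open>x, y, s, t\<close>. It vanishes because
  both the equation for the complex slope and the identity \<open>\<partial>\<zeta> / \<partial>cnj \<zeta> = 0\<close>, expanded by the chain
  rule through \<open>(x, y)\<close>, are linear relations with the coefficient vector \<open>(\<zeta>\<^sub>x, \<zeta>\<^sub>y) \<noteq> 0\<close>. They
  put \<open>(\<partial>x / \<partial>cnj \<zeta>, \<partial>y / \<partial>cnj \<zeta>)\<close> and \<open>(- Gt', Gs')\<close> in the same complex line.\<close>

section \<open>Calculus of \<open>pd\<close> and of the classes \<open>C_on\<close> on open
  sets\<close>

lemma pd_eqI: "(f has_derivative f') (at p) \<Longrightarrow> pd v f p = f' v"
  by (metis frechet_derivative_at pd_def)

lemma has_derivative_pd: "f differentiable (at p) \<Longrightarrow> (f has_derivative (\<lambda>v. pd v f p)) (at p)"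
  by (simp add: pd_def frechet_derivative_works)

text \<open>No differentiability is assumed: \<open>frechet_derivative\<close> is a choice among all
  derivatives at \<open>p\<close>, and functions that agree near \<open>p\<close> have the same
  derivatives there.\<close>

lemma pd_cong:
  assumes "open S" "p \<in> S" "\<And>q. q \<in> S \<Longrightarrow> f q = g q"
  shows "pd v f p = pd v g p"
proof -
  have "(f has_derivative D) (at p) \<longleftrightarrow> (g has_derivative D) (at p)" for D
    using assms by (metis has_derivative_transform_within_open)
  then show ?thesis
    by (simp add: pd_def frechet_derivative_def)
qed

lemma differentiable_cong_open:
  assumes "open S" "p \<in> S" "\<And>q. q \<in> S \<Longrightarrow> f q = g q"
  shows "f differentiable (at p) \<longleftrightarrow> g differentiable (at p)"
  unfolding differentiable_def using assms by (metis has_derivative_transform_within_open)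

lemma C_on_cong:
  assumes "open S" "\<And>q. q \<in> S \<Longrightarrow> f q = g q"
  shows "C_on k S f \<longleftrightarrow> C_on k S g"
  using assms(2)
proof (induction k arbitrary: f g)
  case 0
  then show ?case by (simp cong: continuous_on_cong)
next
  case (Suc k)
  have "C_on k S (pd b f) \<longleftrightarrow> C_on k S (pd b g)" for b
    by (rule Suc.IH) (use assms(1) Suc.prems in \<open>auto intro: pd_cong\<close>)
  moreover have "f differentiable (at p) \<longleftrightarrow> g differentiable (at p)" if "p \<in> S" for p
    by (rule differentiable_cong_open[OF assms(1) that Suc.prems])
  ultimately show ?case by auto
qed

lemma C_on_Suc_imp_C_on: "C_on (Suc k) S f \<Longrightarrow> C_on k S f"
proof (induction k arbitrary: f)
  case 0
  then show ?case
    by (auto intro!: continuous_at_imp_continuous_on differentiable_imp_continuous_within)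
next
  case (Suc k)
  then show ?case by (metis C_on.simps(2))
qed

text \<open>Lets an explicit formula for the derivative replace \<open>pd b f\<close>, so that
  inductions on the order can work with product and chain rule expressions.\<close>

lemma C_on_SucI:
  assumes "open S" and D: "\<And>p. p \<in> S \<Longrightarrow> (f has_derivative f' p) (at p)"
    and "\<And>b. b \<in> Basis \<Longrightarrow> C_on k S (\<lambda>p. f' p b)"
  shows "C_on (Suc k) S f"
proof -
  have "C_on k S (pd b f) \<longleftrightarrow> C_on k S (\<lambda>p. f' p b)" for b
    by (rule C_on_cong[OF assms(1)]) (rule pd_eqI[OF D])
  then show ?thesis
    using assms(3) D[THEN differentiableI] by auto
qed

lemma C_on_bounded_linear:
  assumes "open S" "bounded_linear A" "C_on k S f"
  shows "C_on k S (\<lambda>x. A (f x))"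
  using assms(3)
proof (induction k arbitrary: f)
  case 0
  then show ?case using assms(2) by (simp add: bounded_linear.continuous_on)
next
  case (Suc k)
  show ?case
  proof (rule C_on_SucI[OF assms(1)])
    show "((\<lambda>x. A (f x)) has_derivative (\<lambda>v. A (pd v f p))) (at p)" if "p \<in> S" for p
      using Suc.prems that by (auto intro!: bounded_linear.has_derivative[OF assms(2)] has_derivative_pd)
    show "C_on k S (\<lambda>x. A (pd b f x))" if "b \<in> Basis" for b
      using Suc that by auto
  qed
qed

lemma C_on_add:
  assumes "open S" "C_on k S f" "C_on k S g"
  shows "C_on k S (\<lambda>x. f x + g x)"
  using assms(2,3)
proof (induction k arbitrary: f g)
  case 0
  then show ?case by (simp add: continuous_on_add)
next
  case (Suc k)
  show ?case
  proof (rule C_on_SucI[OF assms(1)])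
    show "((\<lambda>x. f x + g x) has_derivative (\<lambda>v. pd v f p + pd v g p)) (at p)" if "p \<in> S" for p
      using Suc.prems that by (auto intro!: has_derivative_add has_derivative_pd)
    show "C_on k S (\<lambda>x. pd b f x + pd b g x)" if "b \<in> Basis" for b
      using Suc that by auto
  qed
qed

lemma C_on_mult:
  fixes f g :: "'a::euclidean_space \<Rightarrow> 'b::real_normed_algebra"
  assumes "open S" "C_on k S f" "C_on k S g"
  shows "C_on k S (\<lambda>x. f x * g x)"
  using assms(2,3)
proof (induction k arbitrary: f g)
  case 0
  then show ?case by (simp add: continuous_on_mult)
next
  case (Suc k)
  show ?case
  proof (rule C_on_SucI[OF assms(1)])
    show "((\<lambda>x. f x * g x) has_derivative (\<lambda>v. f p * pd v g p + pd v f p * g p)) (at p)"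
      if "p \<in> S" for p
      using Suc.prems that by (auto intro!: has_derivative_mult has_derivative_pd)
    \<comment> \<open>The product rule also contains \<open>f\<close> and \<open>g\<close>
      undifferentiated; their order has to be lowered from \<open>Suc k\<close> to \<open>k\<close>
      before the induction hypothesis applies.\<close>
    show "C_on k S (\<lambda>x. f x * pd b g x + pd b f x * g x)" if "b \<in> Basis" for b
      using Suc.prems that Suc.prems[THEN C_on_Suc_imp_C_on]
      by (intro C_on_add assms(1) Suc.IH) auto
  qed
qed

section \<open>Holomorphic functions and their imaginary parts\<close>

lemma holomorphic_has_derivative:
  assumes "open S" "f holomorphic_on S" "p \<in> S"
  shows "(f has_derivative (\<lambda>v. deriv f p * v)) (at p)"
  using holomorphic_derivI[OF assms(2,1,3)] by (simp add: has_field_derivative_def)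

text \<open>The derivative in direction \<open>b\<close> is \<open>deriv f\<close> times the
  constant \<open>b\<close>, hence again holomorphic.\<close>

lemma holomorphic_imp_C_on:
  assumes "open S" "f holomorphic_on S"
  shows "C_on k S f"
  using assms(2)
proof (induction k arbitrary: f)
  case 0
  then show ?case by (simp add: holomorphic_on_imp_continuous_on)
next
  case (Suc k)
  show ?case
  proof (rule C_on_SucI[OF assms(1)])
    show "C_on k S (\<lambda>x. deriv f x * b)" for b
      using Suc.prems assms(1) by (intro Suc.IH holomorphic_intros)
  qed (rule holomorphic_has_derivative[OF assms(1) Suc.prems])
qed

lemma bounded_linear_of_real_Im: "bounded_linear (\<lambda>z. complex_of_real (Im z))"
  using bounded_linear_compose[OF bounded_linear_of_real bounded_linear_Im] .

lemma has_derivative_of_real_Im: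
  assumes "open S" "G holomorphic_on S" "p \<in> S"
  shows "((\<lambda>x. complex_of_real (Im (G x))) has_derivative
           (\<lambda>v. complex_of_real (Im (deriv G p * v)))) (at p)"
  using bounded_linear.has_derivative[OF bounded_linear_of_real_Im holomorphic_has_derivative[OF assms]] .

text \<open>\<open>Im G\<close> equals \<open>(G - cnj G) / (2 * \<i>)\<close>; only the conjugate
  term contributes, and \<open>- 1 / (2 * \<i>) = \<i> / 2\<close>.\<close>

lemma d_antihol_of_real_Im:
  assumes "open S" "G holomorphic_on S" "p \<in> S"
  shows "d_antihol (\<lambda>x. complex_of_real (Im (G x))) p = \<i> / 2 * cnj (deriv G p)"
  unfolding d_antihol_def pd_eqI[OF has_derivative_of_real_Im[OF assms]]
  by (simp add: complex_eq_iff)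

lemma d_hol_cong:
  assumes "open S" "p \<in> S" "\<And>q. q \<in> S \<Longrightarrow> f q = g q"
  shows "d_hol f p = d_hol g p"
  using pd_cong[OF assms] by (simp add: d_hol_def)

lemma has_derivative_cnj_holomorphic:
  assumes "open S" "f holomorphic_on S" "p \<in> S"
  shows "((\<lambda>x. cnj (f x)) has_derivative (\<lambda>v. cnj (deriv f p * v))) (at p)"
  using bounded_linear.has_derivative[OF bounded_linear_cnj holomorphic_has_derivative[OF assms]] .

text \<open>The first derivative is a constant multiple of \<open>cnj (deriv G)\<close>, an
  antiholomorphic function, which \<open>d_hol\<close> annihilates.\<close>

lemma harmonic_Im:
  assumes "open S" "G holomorphic_on S" "p \<in> S"
  shows "d_hol (d_antihol (\<lambda>x. complex_of_real (Im (G x)))) p = 0"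
proof -
  have "deriv G holomorphic_on S"
    using assms(2,1) by (rule holomorphic_deriv)
  then have D: "((\<lambda>x. \<i> / 2 * cnj (deriv G x)) has_derivative
      (\<lambda>v. \<i> / 2 * cnj (deriv (deriv G) p * v))) (at p)"
    by (intro has_derivative_mult_right has_derivative_cnj_holomorphic[OF assms(1) _ assms(3)])
  have "d_hol (d_antihol (\<lambda>x. complex_of_real (Im (G x)))) p = d_hol (\<lambda>x. \<i> / 2 * cnj (deriv G x)) p"
    by (rule d_hol_cong[OF assms(1,3)]) (rule d_antihol_of_real_Im[OF assms(1,2)])
  also have "\<dots> = 0"
    unfolding d_hol_def pd_eqI[OF D] by simp
  finally show ?thesis .
qed

lemma C_on_of_real_Im:
  assumes "open S" "G holomorphic_on S"
  shows "C_on k S (\<lambda>x. complex_of_real (Im (G x)))"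
  using C_on_bounded_linear[OF assms(1) bounded_linear_of_real_Im holomorphic_imp_C_on[OF assms]] .

section \<open>The intercept in a local coordinate\<close>

text \<open>Here \<open>\<Phi>\<close> stands for the local coordinate as a function of the point of
  the plane, and \<open>g\<close> for its inverse. The hypothesis \<open>pde\<close> is the equation
  for the complex slope, rewritten by the chain rule.\<close>

lemma harmonic_intercept:
  fixes g :: "complex \<Rightarrow> real \<times> real" and \<Phi> :: "real \<times> real \<Rightarrow> complex"
  assumes D: "open D" and g: "C_on 1 D g" and hol: "Gs holomorphic_on D" "Gt holomorphic_on D"
    and gh: "\<And>\<zeta>. \<zeta> \<in> D \<Longrightarrow> grad h (g \<zeta>) = (Im (Gs \<zeta>), Im (Gt \<zeta>))"
    and h: "\<And>\<zeta>. \<zeta> \<in> D \<Longrightarrow> h differentiable (at (g \<zeta>))"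
    and \<Phi>: "\<And>\<zeta>. \<zeta> \<in> D \<Longrightarrow> \<Phi> differentiable (at (g \<zeta>))"
    and inverse: "\<And>\<zeta>. \<zeta> \<in> D \<Longrightarrow> \<Phi> (g \<zeta>) = \<zeta>"
    and pde: "\<And>\<zeta>. \<zeta> \<in> D \<Longrightarrow> deriv Gt \<zeta> * pd_x \<Phi> (g \<zeta>) = deriv Gs \<zeta> * pd_y \<Phi> (g \<zeta>)"
  defines "F \<equiv> \<lambda>\<zeta>. complex_of_real (intercept h (g \<zeta>))"
  shows "C_on 2 D F" "\<And>\<zeta>. \<zeta> \<in> D \<Longrightarrow> d_hol (d_antihol F) \<zeta> = 0"
proof -
  define X where "X = (\<lambda>\<zeta>. complex_of_real (fst (g \<zeta>)))"
  define Y where "Y = (\<lambda>\<zeta>. complex_of_real (snd (g \<zeta>)))"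
  have gD: "(g has_derivative (\<lambda>v. pd v g \<zeta>)) (at \<zeta>)" if "\<zeta> \<in> D" for \<zeta>
    using g that by (auto intro!: has_derivative_pd)
  have XD: "(X has_derivative (\<lambda>v. complex_of_real (fst (pd v g \<zeta>)))) (at \<zeta>)" if "\<zeta> \<in> D" for \<zeta>
    unfolding X_def by (intro has_derivative_of_real has_derivative_fst gD that)
  have YD: "(Y has_derivative (\<lambda>v. complex_of_real (snd (pd v g \<zeta>)))) (at \<zeta>)" if "\<zeta> \<in> D" for \<zeta>
    unfolding Y_def by (intro has_derivative_of_real has_derivative_snd gD that)
  have split: "pd v f p = fst v *\<^sub>R pd_x f p + snd v *\<^sub>R pd_y f p"
    if "f differentiable (at p)" for f :: "real \<times> real \<Rightarrow> 'c::real_normed_vector" and v p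
  proof -
    interpret linear "\<lambda>v. pd v f p"
      using has_derivative_pd[OF that] has_derivative_linear by blast
    have "v = fst v *\<^sub>R (1, 0) + snd v *\<^sub>R (0, 1)"
      by (simp add: prod_eq_iff)
    then show ?thesis
      by (metis add scale)
  qed
  \<comment> \<open>In \<open>dh - s dx - t dy - x ds - y dt\<close> the first three terms cancel
    because \<open>grad h\<close> is \<open>(s, t)\<close>. No derivative of \<open>g\<close>
    survives.\<close>
  have FD: "(F has_derivative (\<lambda>v. - (X \<zeta> * complex_of_real (Im (deriv Gs \<zeta> * v))
      + Y \<zeta> * complex_of_real (Im (deriv Gt \<zeta> * v))))) (at \<zeta>)" if "\<zeta> \<in> D" for \<zeta>
  proof -
    note ImD = has_derivative_Im[OF holomorphic_has_derivative[OF D _ that]]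
    have hD: "((\<lambda>\<zeta>. h (g \<zeta>)) has_derivative (\<lambda>v. pd (pd v g \<zeta>) h (g \<zeta>))) (at \<zeta>)"
      by (rule has_derivative_compose[OF gD[OF that] has_derivative_pd[OF h[OF that]]])
    have hv: "pd (pd v g \<zeta>) h (g \<zeta>)
        = fst (pd v g \<zeta>) * Im (Gs \<zeta>) + snd (pd v g \<zeta>) * Im (Gt \<zeta>)" for v
      using gh[OF that] by (subst split[OF h[OF that]]) (simp add: grad_def)
    have "((\<lambda>\<zeta>. complex_of_real (h (g \<zeta>) - (Im (Gs \<zeta>) * fst (g \<zeta>) + Im (Gt \<zeta>) * snd (g \<zeta>))))
      has_derivative (\<lambda>v. - (X \<zeta> * complex_of_real (Im (deriv Gs \<zeta> * v))
      + Y \<zeta> * complex_of_real (Im (deriv Gt \<zeta> * v))))) (at \<zeta>)"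
      apply (rule has_derivative_eq_rhs)
       apply (rule has_derivative_of_real has_derivative_diff hD has_derivative_add has_derivative_mult
           ImD hol has_derivative_fst has_derivative_snd gD that)+
      apply (simp add: hv X_def Y_def fun_eq_iff algebra_simps)
      done
    then show ?thesis
      by (rule has_derivative_transform_within_open[OF _ D that])
        (simp add: F_def intercept_def gh split_beta)
  qed
  \<comment> \<open>The first derivative of \<open>F\<close> contains \<open>g\<close> only
    undifferentiated, so one order of smoothness is gained over \<open>g\<close>.\<close>
  show "C_on 2 D F"
    unfolding numeral_2_eq_2 One_nat_def[symmetric]
  proof (rule C_on_SucI[OF D FD])
    fix b :: complex
    have "bounded_linear (\<lambda>v :: real \<times> real. complex_of_real (fst v))"
      "bounded_linear (\<lambda>v :: real \<times> real. complex_of_real (snd v))"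
      by (intro bounded_linear_compose[OF bounded_linear_of_real] bounded_linear_fst bounded_linear_snd)+
    from this[THEN C_on_bounded_linear[OF D _ g]] have XY: "C_on 1 D X" "C_on 1 D Y"
      by (simp_all add: X_def Y_def)
    have ST: "C_on 1 D (\<lambda>\<zeta>. complex_of_real (Im (deriv Gs \<zeta> * b)))"
      "C_on 1 D (\<lambda>\<zeta>. complex_of_real (Im (deriv Gt \<zeta> * b)))"
      by (intro C_on_of_real_Im D holomorphic_intros hol)+
    show "C_on 1 D (\<lambda>\<zeta>. - (X \<zeta> * complex_of_real (Im (deriv Gs \<zeta> * b))
      + Y \<zeta> * complex_of_real (Im (deriv Gt \<zeta> * b))))"
      by (intro C_on_bounded_linear[OF D bounded_linear_minus[OF bounded_linear_ident]]
          C_on_add C_on_mult D XY ST)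
  qed
  fix \<zeta> assume \<zeta>: "\<zeta> \<in> D"
  have anti: "d_antihol F \<xi> = - (\<i> / 2) * (X \<xi> * cnj (deriv Gs \<xi>) + Y \<xi> * cnj (deriv Gt \<xi>))"
    if "\<xi> \<in> D" for \<xi>
    unfolding d_antihol_def pd_eqI[OF FD[OF that]] by (simp add: complex_eq_iff X_def Y_def field_simps)
  note cnjD = has_derivative_cnj_holomorphic[OF D holomorphic_deriv[OF _ D] \<zeta>]
  note RD = has_derivative_mult_right[OF has_derivative_add[OF
    has_derivative_mult[OF XD[OF \<zeta>] cnjD[OF hol(1)]] has_derivative_mult[OF YD[OF \<zeta>] cnjD[OF hol(2)]]],
    of "- (\<i> / 2)"]
  \<comment> \<open>The factors \<open>cnj (deriv Gs)\<close> and \<open>cnj (deriv Gt)\<close> are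
    antiholomorphic, so the product rule leaves only the derivatives of \<open>X\<close> and
    \<open>Y\<close>.\<close>
  have eq: "d_hol (d_antihol F) \<zeta> = - (\<i> / 2) * (d_hol X \<zeta> * cnj (deriv Gs \<zeta>) + d_hol Y \<zeta> * cnj (deriv Gt \<zeta>))"
  proof -
    have "d_hol (d_antihol F) \<zeta>
        = d_hol (\<lambda>\<xi>. - (\<i> / 2) * (X \<xi> * cnj (deriv Gs \<xi>) + Y \<xi> * cnj (deriv Gt \<xi>))) \<zeta>"
      by (rule d_hol_cong[OF D \<zeta>]) (rule anti)
    then show ?thesis
      unfolding d_hol_def pd_eqI[OF RD] pd_eqI[OF XD[OF \<zeta>]] pd_eqI[OF YD[OF \<zeta>]]
      by (simp add: field_simps)
  qed
  \<comment> \<open>Chain rule for \<open>\<Phi> (g \<zeta>) = \<zeta>\<close>, with the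
    differential of \<open>\<Phi>\<close> expanded in the two coordinate directions.\<close>
  have idv: "fst (pd v g \<zeta>) *\<^sub>R pd_x \<Phi> (g \<zeta>) + snd (pd v g \<zeta>) *\<^sub>R pd_y \<Phi> (g \<zeta>) = v" for v
  proof -
    have "((\<lambda>\<zeta>. \<Phi> (g \<zeta>)) has_derivative (\<lambda>v. pd (pd v g \<zeta>) \<Phi> (g \<zeta>))) (at \<zeta>)"
      by (rule has_derivative_compose[OF gD[OF \<zeta>] has_derivative_pd[OF \<Phi>[OF \<zeta>]]])
    moreover have "((\<lambda>\<zeta>. \<Phi> (g \<zeta>)) has_derivative (\<lambda>v. v)) (at \<zeta>)"
      by (rule has_derivative_transform_within_open[OF has_derivative_ident D \<zeta>]) (simp add: inverse)
    ultimately have "pd (pd v g \<zeta>) \<Phi> (g \<zeta>) = v"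
      by (metis has_derivative_unique)
    then show ?thesis
      by (subst (asm) split[OF \<Phi>[OF \<zeta>]])
  qed
  define a b where "a = pd_x \<Phi> (g \<zeta>)" and "b = pd_y \<Phi> (g \<zeta>)"
  \<comment> \<open>Since \<open>X\<close> and \<open>Y\<close> are real,
    \<open>cnj (d_hol X \<zeta>)\<close> is \<open>d_antihol X \<zeta>\<close>, and likewise for
    \<open>Y\<close>. The sum is thus the antiholomorphic derivative of the identity, computed from
    the directions \<open>1\<close> and \<open>\<i>\<close>.\<close>
  have anti0: "a * cnj (d_hol X \<zeta>) + b * cnj (d_hol Y \<zeta>) = 0"
  proof -
    have "a * cnj (d_hol X \<zeta>) + b * cnj (d_hol Y \<zeta>) = (1 + \<i> * \<i>) / 2"
      unfolding d_hol_def pd_eqI[OF XD[OF \<zeta>]] pd_eqI[OF YD[OF \<zeta>]]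
      using idv[of 1] idv[of \<i>]
      by (simp add: a_def b_def scaleR_conv_of_real algebra_simps add_divide_distrib[symmetric]
           flip: distrib_left)
    then show ?thesis by simp
  qed
  have nz: "a \<noteq> 0 \<or> b \<noteq> 0"
    using idv[of 1] by (auto simp: a_def b_def)
  have "cnj (d_hol X \<zeta>) * deriv Gs \<zeta> + cnj (d_hol Y \<zeta>) * deriv Gt \<zeta> = 0"
    (is "?x * ?S + ?y * ?T = 0")
  proof -
    have p: "?T * a = ?S * b"
      using pde[OF \<zeta>] by (simp add: a_def b_def)
    \<comment> \<open>By \<open>p\<close>, the two products equal \<open>?S\<close> and
      \<open>?T\<close> times the left side of \<open>anti0\<close>; dividing by whichever of
      \<open>a\<close>, \<open>b\<close> is nonzero avoids any case split on \<open>?S\<close> and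
      \<open>?T\<close>.\<close>
    have "a * (?x * ?S + ?y * ?T) = 0" "b * (?x * ?S + ?y * ?T) = 0"
      using anti0 p by algebra+
    then show ?thesis using nz by auto
  qed
  then have "cnj (cnj (d_hol X \<zeta>) * deriv Gs \<zeta> + cnj (d_hol Y \<zeta>) * deriv Gt \<zeta>) = 0"
    by simp
  then show "d_hol (d_antihol F) \<zeta> = 0"
    unfolding eq by simp
qed

section \<open>Topology of the surface and the branch of the argument\<close>

lemma openin_sphere_Some: "open S \<Longrightarrow> openin sphere (Some ` S)"
  by (auto simp: openin_Alexandroff_compactification)

lemma continuous_map_fst_spectral_curve: "continuous_map spectral_curve sphere fst"
  unfolding spectral_curve_def
  by (intro continuous_map_from_subtopology continuous_map_fst)

text \<open>It is the preimage of the open half-plane, embedded in the sphere, under the first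
  coordinate of the covering.\<close>

lemma openin_upper_part:
  assumes "continuous_map \<Sigma> spectral_curve zw"
  shows "openin \<Sigma> (upper_part \<Sigma> zw)"
proof -
  have c: "continuous_map \<Sigma> sphere (fst \<circ> zw)"
    using continuous_map_compose[OF assms continuous_map_fst_spectral_curve] .
  have "openin \<Sigma> {\<xi> \<in> topspace \<Sigma>. (fst \<circ> zw) \<xi> \<in> Some ` {\<zeta>. Im \<zeta> > 0}}"
    by (rule openin_continuous_map_preimage[OF c openin_sphere_Some[OF open_halfspace_Im_gt]])
  moreover have "{\<xi> \<in> topspace \<Sigma>. (fst \<circ> zw) \<xi> \<in> Some ` {\<zeta>. Im \<zeta> > 0}} = upper_part \<Sigma> zw"
    by (auto simp: upper_part_def)
  ultimately show ?thesis by simp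
qed

text \<open>The last claim makes the coordinate image of the upper part open in the plane, as the
  calculus lemmas require.\<close>

lemma riemann_surface_chart:
  assumes "riemann_surface \<Sigma> A" "(U, \<phi>) \<in> A"
  shows "inj_on \<phi> U" "U \<subseteq> topspace \<Sigma>" "\<And>V. openin \<Sigma> V \<Longrightarrow> open (\<phi> ` (U \<inter> V))"
proof -
  have U: "openin \<Sigma> U" "open (\<phi> ` U)" and
    hm: "homeomorphic_map (subtopology \<Sigma> U) (top_of_set (\<phi> ` U)) \<phi>"
    using assms by (auto simp: riemann_surface_def)
  show sub: "U \<subseteq> topspace \<Sigma>"
    using U by (rule_tac openin_subset)
  then show "inj_on \<phi> U"
    using homeomorphic_imp_injective_map[OF hm] by (simp add: topspace_subtopology inf_absorb2)
  show "open (\<phi> ` (U \<inter> V))" if "openin \<Sigma> V" for V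
  proof -
    have "openin (subtopology \<Sigma> U) (U \<inter> V)"
      using that by (metis openin_subtopology_Int2)
    then have "openin (top_of_set (\<phi> ` U)) (\<phi> ` (U \<inter> V))"
      using hm homeomorphic_imp_open_map open_map_def by blast
    then show ?thesis
      using U(2) openin_open_trans by blast
  qed
qed

text \<open>\<open>Arg2pi\<close> vanishes exactly on the closed positive half-axis, including
  \<open>0\<close> by convention; off it, \<open>- z\<close> avoids the cut of
  \<open>Ln\<close>.\<close>

lemma Arg2pi_pos_imp_uminus_notin_nonpos_Reals:
  assumes "0 < Arg2pi z"
  shows "- z \<notin> \<real>\<^sub>\<le>\<^sub>0"
proof
  assume "- z \<in> \<real>\<^sub>\<le>\<^sub>0"
  then have "z \<in> \<real>" "0 \<le> Re z"
    by (auto simp: complex_nonpos_Reals_iff complex_is_Real_iff)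
  then show False
    using assms Arg2pi_eq_0 by force
qed

section \<open>Harmonicity on the surface, chart by chart\<close>

theorem proposition3:
  fixes \<Omega> L :: "(real \<times> real) set"
    and b h s t c :: "real \<times> real \<Rightarrow> real"
    and z w :: "real \<times> real \<Rightarrow> complex"
    and \<Sigma> :: "'a topology" and A :: "'a chart set"
    and zw :: "'a \<Rightarrow> complex option \<times> complex option"
    and \<Sigma>plus :: "'a set"
    and u :: "real \<times> real \<Rightarrow> 'a"
    and d :: nat
  assumes domain: "open \<Omega>" "connected \<Omega>" "bounded \<Omega>" "\<Omega> \<noteq> {}"
    and height: "limiting_height \<Omega> b h"
    and liquid: "L = liquid_region \<Omega> h" "open L"
    and smooth: "smooth_on L h"
    and euler_lagrange:
      "\<And>p. p \<in> L \<Longrightarrow>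
         pd_x (\<lambda>q. fst (grad surface_tension (grad h q))) p + pd_y (\<lambda>q. snd (grad surface_tension (grad h q))) p = 0"
    and slope: "s = (\<lambda>p. fst (grad h p))" "t = (\<lambda>p. snd (grad h p))"
    and intercept: "c = intercept h"
    and complex_slope_smooth: "smooth_on L z" "smooth_on L w"
    and complex_slope:
      "\<And>p. p \<in> L \<Longrightarrow> dimer_poly (z p) (w p) = 0"
      "\<And>p. p \<in> L \<Longrightarrow> Arg2pi (z p) = - pi * t p \<and> Arg2pi (z p) \<in> {0<..<pi}"
      "\<And>p. p \<in> L \<Longrightarrow> Arg2pi (w p) = pi * s p \<and> Arg2pi (w p) \<in> {pi<..<2 * pi}"
      "\<And>p. p \<in> L \<Longrightarrow> (ln (cmod (z p)), ln (cmod (w p))) = grad surface_tension (s p, t p)"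
      "\<And>p. p \<in> L \<Longrightarrow> pd_x z p / z p + pd_y w p / w p = 0"
    and covering: "d \<ge> 1" "riemann_surface \<Sigma> A"
      "ramified_covering d \<Sigma> A spectral_curve spectral_charts zw"
    and upper: "\<Sigma>plus = upper_part \<Sigma> zw"
    and parametrization: "surface_diffeo L A \<Sigma>plus u"
      "\<And>p. p \<in> L \<Longrightarrow> zw (u p) = (Some (z p), Some (w p))"
  shows "harmonic_on A \<Sigma>plus (\<lambda>\<xi>. s (inv_into L u \<xi>)) \<and>
         harmonic_on A \<Sigma>plus (\<lambda>\<xi>. t (inv_into L u \<xi>)) \<and>
         harmonic_on A \<Sigma>plus (\<lambda>\<xi>. c (inv_into L u \<xi>))"
proof -
  have cont: "continuous_map \<Sigma> spectral_curve zw" and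
    hol: "\<And>U \<phi> V \<psi>. (U, \<phi>) \<in> A \<Longrightarrow> (V, \<psi>) \<in> spectral_charts \<Longrightarrow>
      (\<psi> \<circ> zw \<circ> inv_into U \<phi>) holomorphic_on \<phi> ` (U \<inter> zw -` V)"
    using covering(3) by (auto simp: ramified_covering_def holomorphic_map_def)
  have bij: "bij_betw u L \<Sigma>plus"
    using parametrization(1) by (simp add: surface_diffeo_def)
  have "C_on 2 (\<phi> ` (U \<inter> \<Sigma>plus)) (\<lambda>\<zeta>. complex_of_real (f (inv_into L u (inv_into U \<phi> \<zeta>)))) \<and>
      (\<forall>\<zeta>\<in>\<phi> ` (U \<inter> \<Sigma>plus).
        d_hol (d_antihol (\<lambda>\<zeta>. complex_of_real (f (inv_into L u (inv_into U \<phi> \<zeta>))))) \<zeta> = 0)"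
    if chart: "(U, \<phi>) \<in> A" and f: "f \<in> {s, t, c}" for U \<phi> f
  proof -
    \<comment> \<open>Within one chart, \<open>g\<close> and \<open>\<phi> \<circ> u\<close> will be
      mutually inverse maps between \<open>D\<close> and the part \<open>E\<close> of the liquid
      region.\<close>
    define D where "D = \<phi> ` (U \<inter> \<Sigma>plus)"
    define g where "g = inv_into L u \<circ> inv_into U \<phi>"
    define E where "E = L \<inter> u -` U"
    define Z where "Z = (\<lambda>\<zeta>. the (fst (zw (inv_into U \<phi> \<zeta>))))"
    \<comment> \<open>This is \<open>dimer_poly z w = 0\<close> solved for \<open>w\<close>, so
      holomorphy of \<open>w\<close> follows from that of \<open>z\<close>. The pole
      \<open>1\<close> is excluded because \<open>Arg2pi 1 = 0\<close>.\<close>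
    define W where "W = (\<lambda>\<zeta>. (1 + Z \<zeta>) / (Z \<zeta> - 1))"
    note chart_facts = riemann_surface_chart[OF covering(2) chart]
    have opD: "open D"
      unfolding D_def upper by (intro chart_facts(3) openin_upper_part cont)
    have opE: "open E" and \<Phi>_smooth: "smooth_on E (\<phi> \<circ> u)" and g_smooth: "smooth_on D g"
      using parametrization(1) chart by (auto simp: surface_diffeo_def D_def E_def g_def)
    have gE: "g \<zeta> \<in> E" and \<Phi>g: "\<phi> (u (g \<zeta>)) = \<zeta>" and ug: "u (g \<zeta>) = inv_into U \<phi> \<zeta>"
      if \<zeta>: "\<zeta> \<in> D" for \<zeta>
    proof -
      obtain \<xi> where \<xi>: "\<xi> \<in> U" "\<xi> \<in> \<Sigma>plus" "\<zeta> = \<phi> \<xi>"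
        using \<zeta> by (auto simp: D_def)
      then have i: "inv_into U \<phi> \<zeta> = \<xi>"
        using chart_facts(1) by simp
      have "u (inv_into L u \<xi>) = \<xi>" "inv_into L u \<xi> \<in> L"
        using bij \<xi>(2) by (auto simp: bij_betw_def f_inv_into_f inv_into_into)
      then show "g \<zeta> \<in> E" "\<phi> (u (g \<zeta>)) = \<zeta>" "u (g \<zeta>) = inv_into U \<phi> \<zeta>"
        using \<xi>(1,3) i by (simp_all add: g_def E_def)
    qed
    have gL: "g \<zeta> \<in> L" if "\<zeta> \<in> D" for \<zeta>
      using gE[OF that] by (simp add: E_def)
    have \<Phi>D: "\<phi> (u p) \<in> D" and g\<Phi>: "g (\<phi> (u p)) = p" if "p \<in> E" for p
      using that bij chart_facts(1) by (auto simp: E_def D_def g_def bij_betw_def)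
    have zZ: "z (g \<zeta>) = Z \<zeta>" if "\<zeta> \<in> D" for \<zeta>
      using parametrization(2)[OF gL[OF that]] ug[OF that] by (simp add: Z_def)
    have Z1: "Z \<zeta> \<noteq> 1" if "\<zeta> \<in> D" for \<zeta>
      using complex_slope(2)[OF gL[OF that]] zZ[OF that] Arg2pi_eq_0[of 1] by auto
    have wW: "w (g \<zeta>) = W \<zeta>" if "\<zeta> \<in> D" for \<zeta>
      using complex_slope(1)[OF gL[OF that]] Z1[OF that]
      by (simp add: zZ[OF that] W_def dimer_poly_def divide_simps) (simp add: algebra_simps)
    have Zhol: "Z holomorphic_on D"
    proof -
      \<comment> \<open>The finite chart of the sphere after \<open>fst\<close> is a chart of the
        spectral curve in which \<open>zw\<close> reads as \<open>Z\<close>, and the upper part lies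
        over finite values of \<open>z\<close>.\<close>
      let ?V = "topspace spectral_curve \<inter> fst -` range Some"
      have "(?V, the \<circ> fst) \<in> spectral_charts"
        by (auto simp: spectral_charts_def sphere_charts_def)
      from hol[OF chart this] have "Z holomorphic_on \<phi> ` (U \<inter> zw -` ?V)"
        by (simp add: Z_def comp_def)
      moreover have "D \<subseteq> \<phi> ` (U \<inter> zw -` ?V)"
        using continuous_map_image_subset_topspace[OF cont]
        by (auto simp: D_def upper upper_part_def)
      ultimately show ?thesis by (rule holomorphic_on_subset)
    qed
    have Whol: "W holomorphic_on D"
      unfolding W_def using Z1 by (intro holomorphic_intros Zhol) auto
    have argZ: "0 < Arg2pi (Z \<zeta>)" and argW: "0 < Arg2pi (W \<zeta>)" if "\<zeta> \<in> D" for \<zeta>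
      using complex_slope(2,3)[OF gL[OF that]] zZ[OF that] wW[OF that] pi_gt_zero by auto
    note slit = Arg2pi_pos_imp_uminus_notin_nonpos_Reals
    have Z0: "Z \<zeta> \<noteq> 0" and W0: "W \<zeta> \<noteq> 0" if "\<zeta> \<in> D" for \<zeta>
      using argZ[OF that] argW[OF that] by auto
    \<comment> \<open>The imaginary part of \<open>Ln (- W \<zeta>)\<close> is
      \<open>Arg2pi (W \<zeta>) - pi\<close>. After division by \<open>pi\<close> the summand
      \<open>\<i>\<close> restores the shift, and similarly for \<open>Gt\<close> with the opposite
      sign.\<close>
    define Gs where "Gs = (\<lambda>\<zeta>. Ln (- W \<zeta>) / of_real pi + \<i>)"
    define Gt where "Gt = (\<lambda>\<zeta>. - Ln (- Z \<zeta>) / of_real pi - \<i>)"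
    have Ghol: "Gs holomorphic_on D" "Gt holomorphic_on D"
      unfolding Gs_def Gt_def using slit[OF argW] slit[OF argZ]
      by (intro holomorphic_intros Whol Zhol; simp)+
    have dGs: "deriv Gs \<zeta> = deriv W \<zeta> / W \<zeta> / of_real pi" if "\<zeta> \<in> D" for \<zeta>
      unfolding Gs_def using slit[OF argW[OF that]] W0[OF that]
      by (intro DERIV_imp_deriv)
        (auto intro!: derivative_eq_intros holomorphic_derivI[OF Whol opD that] simp: field_simps)
    have dGt: "deriv Gt \<zeta> = - deriv Z \<zeta> / Z \<zeta> / of_real pi" if "\<zeta> \<in> D" for \<zeta>
      unfolding Gt_def using slit[OF argZ[OF that]] Z0[OF that]
      by (intro DERIV_imp_deriv)
        (auto intro!: derivative_eq_intros holomorphic_derivI[OF Zhol opD that] simp: field_simps)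
    have sG: "s (g \<zeta>) = Im (Gs \<zeta>)" if "\<zeta> \<in> D" for \<zeta>
      using complex_slope(3)[OF gL[OF that]] Arg2pi_Ln[OF argW[OF that]]
      by (simp add: wW[OF that] Gs_def field_simps)
    have tG: "t (g \<zeta>) = Im (Gt \<zeta>)" if "\<zeta> \<in> D" for \<zeta>
      using complex_slope(2)[OF gL[OF that]] Arg2pi_Ln[OF argZ[OF that]]
      by (simp add: zZ[OF that] Gt_def field_simps)
    have \<Phi>_diff: "(\<phi> \<circ> u) differentiable (at p)" if "p \<in> E" for p
      using \<Phi>_smooth that unfolding smooth_on_def by (metis C_on.simps(2))
    \<comment> \<open>On \<open>E\<close> the function \<open>k\<close> is \<open>K\<close> composed
      with \<open>\<phi> \<circ> u\<close>; this turns derivatives of \<open>z\<close> and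
      \<open>w\<close> in the plane into \<open>deriv Z\<close> and \<open>deriv W\<close>.\<close>
    have pullback: "pd v k p = deriv K (\<phi> (u p)) * pd v (\<phi> \<circ> u) p"
      if "p \<in> E" "K holomorphic_on D" "\<And>\<zeta>. \<zeta> \<in> D \<Longrightarrow> k (g \<zeta>) = K \<zeta>" for v k K p
    proof (rule pd_eqI)
      have "((\<lambda>q. K ((\<phi> \<circ> u) q)) has_derivative (\<lambda>v. deriv K (\<phi> (u p)) * pd v (\<phi> \<circ> u) p)) (at p)"
        using has_derivative_compose[OF has_derivative_pd[OF \<Phi>_diff[OF that(1)]]]
          holomorphic_has_derivative[OF opD that(2)] \<Phi>D[OF that(1)] by fastforce
      then show "(k has_derivative (\<lambda>v. deriv K (\<phi> (u p)) * pd v (\<phi> \<circ> u) p)) (at p)"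
        by (rule has_derivative_transform_within_open[OF _ opE that(1)]) (metis that(3) \<Phi>D g\<Phi> comp_apply)
    qed
    have pde: "deriv Gt \<zeta> * pd_x (\<phi> \<circ> u) (g \<zeta>) = deriv Gs \<zeta> * pd_y (\<phi> \<circ> u) (g \<zeta>)"
      if "\<zeta> \<in> D" for \<zeta>
    proof -
      \<comment> \<open>The complex slope equation in the coordinate; division by
        \<open>- pi\<close> turns the logarithmic derivatives into those of \<open>Gt\<close> and
        \<open>Gs\<close>.\<close>
      have "deriv Z \<zeta> / Z \<zeta> * pd_x (\<phi> \<circ> u) (g \<zeta>) = - (deriv W \<zeta> / W \<zeta> * pd_y (\<phi> \<circ> u) (g \<zeta>))"
        using complex_slope(5)[OF gL[OF that]] pullback[OF gE[OF that] Zhol zZ]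
          pullback[OF gE[OF that] Whol wW]
        by (simp add: zZ wW \<Phi>g that add_eq_0_iff2)
      from arg_cong[OF this, of "\<lambda>v. - v / of_real pi"] show ?thesis
        by (simp add: dGs dGt that)
    qed
    have "C_on 1 D g"
      using g_smooth smooth_on_def by blast
    note harm = harmonic_intercept[OF opD this Ghol, where h = h and \<Phi> = "\<phi> \<circ> u"]
    have h_diff: "h differentiable (at (g \<zeta>))" if "\<zeta> \<in> D" for \<zeta>
      using gL[OF that] liquid(1) by (simp add: liquid_region_def)
    have grad_h: "grad h (g \<zeta>) = (Im (Gs \<zeta>), Im (Gt \<zeta>))" if "\<zeta> \<in> D" for \<zeta>
      using sG[OF that] tG[OF that] by (simp add: slope prod_eq_iff)
    have c_harm: "C_on 2 D (\<lambda>\<zeta>. complex_of_real (c (g \<zeta>)))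
        \<and> (\<forall>\<zeta>\<in>D. d_hol (d_antihol (\<lambda>\<zeta>. complex_of_real (c (g \<zeta>)))) \<zeta> = 0)"
      unfolding intercept
      using harm[OF grad_h h_diff \<Phi>_diff[OF gE] _ pde] \<Phi>g by simp
    \<comment> \<open>The two functions agree only on \<open>D\<close>, so the equality is carried
      through each derivative using that \<open>D\<close> is open.\<close>
    have Im_harm: "C_on 2 D (\<lambda>\<zeta>. complex_of_real (k (g \<zeta>)))
        \<and> (\<forall>\<zeta>\<in>D. d_hol (d_antihol (\<lambda>\<zeta>. complex_of_real (k (g \<zeta>)))) \<zeta> = 0)"
      if G: "G holomorphic_on D" and k: "\<And>\<zeta>. \<zeta> \<in> D \<Longrightarrow> k (g \<zeta>) = Im (G \<zeta>)" for k G
    proof -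
      have "d_antihol (\<lambda>\<zeta>. complex_of_real (k (g \<zeta>))) \<zeta> = d_antihol (\<lambda>\<zeta>. complex_of_real (Im (G \<zeta>))) \<zeta>"
        if "\<zeta> \<in> D" for \<zeta>
      proof -
        have "pd v (\<lambda>\<zeta>. complex_of_real (k (g \<zeta>))) \<zeta> = pd v (\<lambda>\<zeta>. complex_of_real (Im (G \<zeta>))) \<zeta>" for v
          by (rule pd_cong[OF opD that]) (simp add: k)
        then show ?thesis by (simp add: d_antihol_def)
      qed
      then have "d_hol (d_antihol (\<lambda>\<zeta>. complex_of_real (k (g \<zeta>)))) \<zeta>
          = d_hol (d_antihol (\<lambda>\<zeta>. complex_of_real (Im (G \<zeta>)))) \<zeta>" if "\<zeta> \<in> D" for \<zeta>
        by (rule d_hol_cong[OF opD that])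
      then have "d_hol (d_antihol (\<lambda>\<zeta>. complex_of_real (k (g \<zeta>)))) \<zeta> = 0" if "\<zeta> \<in> D" for \<zeta>
        using harmonic_Im[OF opD G that] that by simp
      moreover have "C_on 2 D (\<lambda>\<zeta>. complex_of_real (k (g \<zeta>)))"
        using C_on_cong[OF opD, of "\<lambda>\<zeta>. complex_of_real (k (g \<zeta>))" "\<lambda>\<zeta>. complex_of_real (Im (G \<zeta>))"]
          C_on_of_real_Im[OF opD G] k by simp
      ultimately show ?thesis by blast
    qed
    have "C_on 2 D (\<lambda>\<zeta>. complex_of_real (f (g \<zeta>)))
        \<and> (\<forall>\<zeta>\<in>D. d_hol (d_antihol (\<lambda>\<zeta>. complex_of_real (f (g \<zeta>)))) \<zeta> = 0)"
      using f c_harm Im_harm[OF Ghol(1) sG] Im_harm[OF Ghol(2) tG] by blast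
    then show ?thesis
      by (simp add: D_def g_def)
  qed
  then show ?thesis
    unfolding harmonic_on_def Let_def by blast
qed

end
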